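(* Let $x^{k+1},y_2^k\in\mathbb{R}^m$, $y_1^k\in\mathbb{R}$ and $\rho>0$ be given, and consider the unconstrained minimization problem $$\min_{w\in\mathbb{R}^m}\ \Vert w-x^{k+1}+y_2^k/\rho\Vert_2^2+\bigl\Vert \Vert w\Vert_2^2-1+y_1^k/\rho\bigr\Vert_2^2 .$$ The solution to this problem is $$w=(x^{k+1}-y_2^k/\rho)/(2\Vert w\Vert_2^2-1+2y_1^k/\rho),$$ where $u=\Vert w\Vert_2$ is obtained uniquely from one real root of the following cubic equation: $$\left\vert 2u^3-u+2u\,y_1^k/\rho\right\vert=\Vert x^{k+1}-y_2^k/\rho\Vert_2 .$$
   Context: $\Vert\cdot\Vert_2$ is the Euclidean norm (on a scalar it is the absolute value). The superscripts $k$ and $k+1$ are iteration indices; $x^{k+1}$, $y_1^k$, $y_2^k$, $\rho$ are fixed data when $w$ is computed. The problem is the $w$-update of an alternating direction method of multipliers applied to minimizing a loss $\ell(x)$ subject to $\Vert w\Vert_2^2=1$ and $w=x$, with penalty parameter $\rho$, scalar dual variable $y_1$ for the constraint $\Vert w\Vert_2^2-1=0$, and vector dual variable $y_2$ for the constraint $w-x=0$. "Solution" means a global minimizer.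
   Formalization: The quotient formula and uniqueness of w are claimed only if x^{k+1}≠y_2^k/ρ or y_1^k/ρ>1/2 (otherwise the denominator is 0 at every minimizer, and only the form with the denominator cleared is claimed); u is specified as the greatest real root of the cubic, since it can have several. *)

theory Defs
  imports "HOL-Analysis.Analysis"
begin

definition w_objective ::
  "real ^ 'm \<Rightarrow> real \<Rightarrow> real ^ 'm \<Rightarrow> real \<Rightarrow> real ^ 'm \<Rightarrow> real" where
  "w_objective x y1 y2 \<rho> w =
     (norm (w - x + y2 /\<^sub>R \<rho>))\<^sup>2 + (norm ((norm w)\<^sup>2 - 1 + y1 / \<rho>))\<^sup>2"

definition w_solution ::
  "real ^ 'm \<Rightarrow> real \<Rightarrow> real ^ 'm \<Rightarrow> real \<Rightarrow> real ^ 'm \<Rightarrow> bool" where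
  "w_solution x y1 y2 \<rho> w \<longleftrightarrow> is_arg_min (w_objective x y1 y2 \<rho>) (\<lambda>_. True) w"

definition cubic_root ::
  "real ^ 'm \<Rightarrow> real \<Rightarrow> real ^ 'm \<Rightarrow> real \<Rightarrow> real \<Rightarrow> bool" where
  "cubic_root x y1 y2 \<rho> u \<longleftrightarrow>
     \<bar>2 * u ^ 3 - u + 2 * u * y1 / \<rho>\<bar> = norm (x - y2 /\<^sub>R \<rho>)"

(* The equation is even in u and can have several nonnegative roots; the one
   attained by the norm of a global minimizer is the greatest. *)
definition greatest_cubic_root ::
  "real ^ 'm \<Rightarrow> real \<Rightarrow> real ^ 'm \<Rightarrow> real \<Rightarrow> real \<Rightarrow> bool" where
  "greatest_cubic_root x y1 y2 \<rho> u \<longleftrightarrow>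
     cubic_root x y1 y2 \<rho> u \<and> (\<forall>v. cubic_root x y1 y2 \<rho> v \<longrightarrow> v \<le> u)"

end

(* Put a = x - y2/rho and s = 2|w|^2 - 1 + 2 y1/rho. If s w = a, then for every v
   the objective at v exceeds the objective at w by exactly
   (|v|^2 - |w|^2)^2 + s |v - w|^2, so w is a global minimizer as soon as s >= 0,
   and every other minimizer has the same norm and satisfies s v = a.
   If |w| is the greatest root of the cubic, then s >= 0: if s < 0,
   the intermediate value theorem gives a root beyond sqrt ((1 - 2 y1/rho) / 2) > |w|. *)
theory Submission imports Defs begin

text \<open>Since \<open>u\<close> dominates \<open>1\<close> and \<open>\<bar>b\<bar>\<close>, the
  factor \<open>2 * u\<^sup>2 + b\<close> is at least \<open>1\<close>, so the cubic is at least
  \<open>u > r\<close>. The explicit threshold serves as right endpoint for the intermediate value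
  theorem and as an upper bound on all roots.\<close>

lemma depressed_cubic_gt:
  fixes b r u :: real
  assumes "r \<ge> 0" "u \<ge> 1 + \<bar>b\<bar> + r"
  shows "2 * u ^ 3 + b * u > r"
proof -
  have u: "u \<ge> 1" "\<bar>b\<bar> \<le> u" "r < u" using assms by auto
  have "u * 1 \<le> u * (2 * u - \<bar>b\<bar>)"
    using u by (intro mult_left_mono) auto
  also have "\<dots> \<le> u * (2 * u\<^sup>2 + b)"
  proof (intro mult_left_mono)
    have "u * 1 \<le> u * u" using u by (intro mult_left_mono) auto
    then show "2 * u - \<bar>b\<bar> \<le> 2 * u\<^sup>2 + b" by (simp add: power2_eq_square)
  qed (use u in auto)
  also have "\<dots> = 2 * u ^ 3 + b * u" by (simp add: power2_eq_square power3_eq_cube algebra_simps)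
  finally show ?thesis using u by simp
qed

lemma depressed_cubic_root_above:
  fixes b r v :: real
  assumes "r \<ge> 0" "2 * v ^ 3 + b * v \<le> r"
  obtains u where "u \<ge> v" "2 * u ^ 3 + b * u = r"
proof -
  \<comment> \<open>The maximum keeps \<open>K\<close> to the right of \<open>v\<close> while the
    cubic already exceeds \<open>r\<close> there.\<close>
  define K where "K = max v (1 + \<bar>b\<bar> + r)"
  have "\<exists>u. v \<le> u \<and> u \<le> K \<and> 2 * u ^ 3 + b * u = r"
    using assms depressed_cubic_gt[OF assms(1), of b K]
    by (intro IVT') (auto simp: K_def intro!: continuous_intros)
  then show ?thesis using that by blast
qed

text \<open>The nonnegative roots form a set that is closed as a preimage of \<open>{r}\<close>,
  bounded by \<open>K\<close>, and nonempty because the cubic vanishes at \<open>0\<close> and later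
  reaches \<open>r\<close>. A compact nonempty set has a maximum, and negative roots lie below it
  anyway.\<close>

lemma greatest_abs_cubic_root_exists:
  fixes b r :: real
  assumes "r \<ge> 0"
  shows "\<exists>u\<ge>0. \<bar>2 * u ^ 3 + b * u\<bar> = r \<and> (\<forall>v. \<bar>2 * v ^ 3 + b * v\<bar> = r \<longrightarrow> v \<le> u)"
proof -
  define K where "K = 1 + \<bar>b\<bar> + r"
  define S where "S = {0..K} \<inter> (\<lambda>u. \<bar>2 * u ^ 3 + b * u\<bar>) -` {r}"
  have le_K: "v \<le> K" if "\<bar>2 * v ^ 3 + b * v\<bar> = r" for v
    using depressed_cubic_gt[OF assms, of b v] that by (force simp: K_def)
  have "continuous_on UNIV (\<lambda>u::real. \<bar>2 * u ^ 3 + b * u\<bar>)"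
    by (intro continuous_intros)
  then have "closed ((\<lambda>u. \<bar>2 * u ^ 3 + b * u\<bar>) -` {r})"
    by (intro closed_vimage) auto
  then have "compact S" unfolding S_def by (intro compact_Int_closed) auto
  moreover obtain u0 where "u0 \<ge> 0" "2 * u0 ^ 3 + b * u0 = r"
    using depressed_cubic_root_above[of r 0 b] assms by auto
  then have "u0 \<in> S" using assms le_K[of u0] by (auto simp: S_def)
  ultimately obtain u where u: "u \<in> S" "\<And>v. v \<in> S \<Longrightarrow> v \<le> u"
    using compact_attains_sup[of S] by blast
  show ?thesis
  proof (intro exI[of _ u] conjI allI impI)
    fix v assume v: "\<bar>2 * v ^ 3 + b * v\<bar> = r"
    show "v \<le> u"
    proof (cases "v \<ge> 0")
      case True
      then show ?thesis using u(2)[of v] v le_K[OF v] by (auto simp: S_def)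
    next
      case False
      then show ?thesis using u(1) by (auto simp: S_def)
    qed
  qed (use u in \<open>auto simp: S_def\<close>)
qed

lemma greatest_abs_cubic_root_slope_nonneg:
  fixes b r u :: real
  assumes "r \<ge> 0" "u \<ge> 0" and max: "\<And>v. \<bar>2 * v ^ 3 + b * v\<bar> = r \<Longrightarrow> v \<le> u"
  shows "2 * u\<^sup>2 + b \<ge> 0"
proof (rule ccontr)
  assume "\<not> ?thesis"
  then have neg: "u\<^sup>2 < - b / 2" by simp
  \<comment> \<open>This is the positive zero of \<open>2 * v\<^sup>2 + b\<close>, so the cubic is
    \<open>0 \<le> r\<close> there and a root lies at or beyond \<open>v\<close>.\<close>
  define v where "v = sqrt (- b / 2)"
  have "u < v" unfolding v_def using neg by (rule real_less_rsqrt)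
  have "v\<^sup>2 = - b / 2" unfolding v_def using neg by (smt (verit) real_sqrt_pow2 zero_le_power2)
  then have "2 * v ^ 3 + b * v = 0"
    by (simp add: power3_eq_cube power2_eq_square)
  then obtain t where "t \<ge> v" "2 * t ^ 3 + b * t = r"
    using depressed_cubic_root_above[of r v b] assms(1) by auto
  then show False using max[of t] \<open>u < v\<close> assms(1) by auto
qed

lemma w_objective_diff:
  fixes x y2 :: "real ^ 'm"
  assumes "s = 2 * (norm w)\<^sup>2 - 1 + 2 * y1 / \<rho>" "s *\<^sub>R w = x - y2 /\<^sub>R \<rho>"
  shows "w_objective x y1 y2 \<rho> v
    = w_objective x y1 y2 \<rho> w + ((norm v)\<^sup>2 - (norm w)\<^sup>2)\<^sup>2 + s * (norm (v - w))\<^sup>2"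
proof -
  \<comment> \<open>The two substitutions eliminate \<open>x\<close>, \<open>y2\<close> and
    \<open>y1\<close> in favour of \<open>s\<close> and \<open>w\<close>; what remains is a
    polynomial identity in inner products.\<close>
  have shift: "z - x + y2 /\<^sub>R \<rho> = z - s *\<^sub>R w" for z
    unfolding assms(2) by (simp add: algebra_simps)
  have y1: "y1 / \<rho> = (s + 1) / 2 - w \<bullet> w"
    using assms(1) by (simp add: power2_norm_eq_inner field_simps)
  show ?thesis
    unfolding w_objective_def shift y1
    by (simp add: power2_norm_eq_inner inner_diff_left inner_diff_right inner_commute[of w v])
      (simp add: power2_eq_square field_simps)
qed

context
  fixes x y2 :: "real ^ 'm" and y1 \<rho> :: real
begin

text \<open>Links the equation to the real lemmas above, with
  \<open>b = 2 * y1 / \<rho> - 1\<close>; then \<open>2 * u\<^sup>2 + b\<close> is the factor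
  s.\<close>

lemma cubic_root_iff:
  "cubic_root x y1 y2 \<rho> u \<longleftrightarrow>
     \<bar>2 * u ^ 3 + (2 * y1 / \<rho> - 1) * u\<bar> = norm (x - y2 /\<^sub>R \<rho>)"
  by (simp add: cubic_root_def algebra_simps)

lemma greatest_cubic_root_exists:
  "\<exists>u\<ge>0. greatest_cubic_root x y1 y2 \<rho> u"
  unfolding greatest_cubic_root_def cubic_root_iff
  by (intro greatest_abs_cubic_root_exists norm_ge_zero)

lemma greatest_cubic_root_slope_nonneg:
  assumes "u \<ge> 0" "greatest_cubic_root x y1 y2 \<rho> u"
  shows "2 * u\<^sup>2 - 1 + 2 * y1 / \<rho> \<ge> 0"
proof -
  have "2 * u\<^sup>2 + (2 * y1 / \<rho> - 1) \<ge> 0"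
    using assms(2) unfolding greatest_cubic_root_def cubic_root_iff
    by (intro greatest_abs_cubic_root_slope_nonneg[OF norm_ge_zero assms(1)]) blast
  then show ?thesis by simp
qed

lemma stationary_point_exists:
  obtains w where "greatest_cubic_root x y1 y2 \<rho> (norm w)"
    "(2 * (norm w)\<^sup>2 - 1 + 2 * y1 / \<rho>) *\<^sub>R w = x - y2 /\<^sub>R \<rho>"
proof -
  obtain u where u: "u \<ge> 0" "greatest_cubic_root x y1 y2 \<rho> u"
    using greatest_cubic_root_exists by blast
  define s where "s = 2 * u\<^sup>2 - 1 + 2 * y1 / \<rho>"
  have "s \<ge> 0" unfolding s_def using u by (rule greatest_cubic_root_slope_nonneg)
  have "2 * u ^ 3 + (2 * y1 / \<rho> - 1) * u = s * u"
    by (simp add: s_def power2_eq_square power3_eq_cube algebra_simps)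
  \<comment> \<open>The absolute value drops because \<open>s\<close> and \<open>u\<close> are both
    nonnegative.\<close>
  then have su: "s * u = norm (x - y2 /\<^sub>R \<rho>)"
    using u \<open>s \<ge> 0\<close> by (simp add: greatest_cubic_root_def cubic_root_iff)
  show ?thesis
  proof (cases "s = 0")
    case True
    \<comment> \<open>Here \<open>su\<close> forces \<open>x - y2 /\<^sub>R \<rho> = 0\<close>, so
      every vector of norm \<open>u\<close> satisfies the equation.\<close>
    obtain w :: "real ^ 'm" where "norm w = u"
      using vector_choose_size[OF u(1)] by blast
    then show ?thesis using that[of w] u True su by (simp add: s_def)
  next
    case False
    define w where "w = (x - y2 /\<^sub>R \<rho>) /\<^sub>R s"
    have "norm w = u" using False \<open>s \<ge> 0\<close> by (simp add: w_def flip: su)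
    then show ?thesis using that[of w] u False by (simp add: w_def flip: s_def)
  qed
qed

lemma w_solution_iff_le:
  "w_solution x y1 y2 \<rho> w \<longleftrightarrow> (\<forall>v. w_objective x y1 y2 \<rho> w \<le> w_objective x y1 y2 \<rho> v)"
  unfolding w_solution_def is_arg_min_linorder by blast

lemma stationary_point_solution:
  assumes "greatest_cubic_root x y1 y2 \<rho> (norm w)"
    "(2 * (norm w)\<^sup>2 - 1 + 2 * y1 / \<rho>) *\<^sub>R w = x - y2 /\<^sub>R \<rho>"
  shows "w_solution x y1 y2 \<rho> w"
proof -
  have slope: "2 * (norm w)\<^sup>2 - 1 + 2 * y1 / \<rho> \<ge> 0"
    using assms(1) by (rule greatest_cubic_root_slope_nonneg[OF norm_ge_zero])
  show ?thesis
    unfolding w_solution_iff_le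
  proof
    fix v
    show "w_objective x y1 y2 \<rho> w \<le> w_objective x y1 y2 \<rho> v"
      unfolding w_objective_diff[OF refl assms(2), of v] using slope by simp
  qed
qed

text \<open>By \<open>w_objective_diff\<close> the excess of \<open>v\<close> over \<open>w\<close>
  is a sum of two nonnegative terms, and minimality of \<open>v\<close> makes it at most
  \<open>0\<close>. Both terms vanish: the first gives equal norms, the second the
  alternative.\<close>

lemma solution_compare:
  assumes w: "greatest_cubic_root x y1 y2 \<rho> (norm w)"
    "(2 * (norm w)\<^sup>2 - 1 + 2 * y1 / \<rho>) *\<^sub>R w = x - y2 /\<^sub>R \<rho>"
    and v: "w_solution x y1 y2 \<rho> v"
  shows "norm v = norm w" "2 * (norm w)\<^sup>2 - 1 + 2 * y1 / \<rho> = 0 \<or> v = w"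
proof -
  define s where "s = 2 * (norm w)\<^sup>2 - 1 + 2 * y1 / \<rho>"
  have "s \<ge> 0"
    unfolding s_def using w(1) by (rule greatest_cubic_root_slope_nonneg[OF norm_ge_zero])
  then have "s * (norm (v - w))\<^sup>2 \<ge> 0" by simp
  moreover have "((norm v)\<^sup>2 - (norm w)\<^sup>2)\<^sup>2 + s * (norm (v - w))\<^sup>2 \<le> 0"
    using v w_objective_diff[OF s_def w(2)[folded s_def], of v]
    unfolding w_solution_iff_le by (smt (verit))
  ultimately have "((norm v)\<^sup>2 - (norm w)\<^sup>2)\<^sup>2 = 0" "s * (norm (v - w))\<^sup>2 = 0"
    using zero_le_power2[of "(norm v)\<^sup>2 - (norm w)\<^sup>2"] by linarith+
  then show "norm v = norm w" "2 * (norm w)\<^sup>2 - 1 + 2 * y1 / \<rho> = 0 \<or> v = w"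
    by (auto simp flip: s_def)
qed

text \<open>For the forward direction, compare with a known stationary point \<open>w'\<close>.
  Equal norms carry over the root and the factor s; either \<open>w = w'\<close>, or s is
  \<open>0\<close> and the equation no longer depends on the vector.\<close>

lemma w_solution_iff:
  "w_solution x y1 y2 \<rho> w \<longleftrightarrow> greatest_cubic_root x y1 y2 \<rho> (norm w)
     \<and> (2 * (norm w)\<^sup>2 - 1 + 2 * y1 / \<rho>) *\<^sub>R w = x - y2 /\<^sub>R \<rho>"
proof
  assume "w_solution x y1 y2 \<rho> w"
  moreover obtain w' where w': "greatest_cubic_root x y1 y2 \<rho> (norm w')"
    "(2 * (norm w')\<^sup>2 - 1 + 2 * y1 / \<rho>) *\<^sub>R w' = x - y2 /\<^sub>R \<rho>"
    by (rule stationary_point_exists)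
  ultimately show "greatest_cubic_root x y1 y2 \<rho> (norm w)
     \<and> (2 * (norm w)\<^sup>2 - 1 + 2 * y1 / \<rho>) *\<^sub>R w = x - y2 /\<^sub>R \<rho>"
    using solution_compare[OF w', of w] by auto
qed (use stationary_point_solution in blast)

lemma solution_slope_nonzero:
  assumes "w_solution x y1 y2 \<rho> w" "x - y2 /\<^sub>R \<rho> \<noteq> 0 \<or> y1 / \<rho> > 1 / 2"
  shows "2 * (norm w)\<^sup>2 - 1 + 2 * y1 / \<rho> \<noteq> 0"
  using assms(2)
proof
  assume "x - y2 /\<^sub>R \<rho> \<noteq> 0"
  then show ?thesis using assms(1) unfolding w_solution_iff by auto
next
  assume "y1 / \<rho> > 1 / 2"
  then have "2 * y1 / \<rho> > 1" by (simp add: mult.commute)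
  then show ?thesis using zero_le_power2[of "norm w"] by linarith
qed

end

text \<open>The cubic may have several nonnegative roots; the common norm of the minimizers singles
  one out. The equation is kept in product form because for x = y2/rho and y1/rho \<le> 1/2 the
  minimizers fill the sphere of radius sqrt (1/2 - y1/rho), where the factor s is 0. The quotient
  form is stated for the other cases.\<close>

theorem theorem1:
  fixes x y2 :: "real ^ 'm" and y1 \<rho> :: real
  assumes "\<rho> > 0"
  shows "(\<exists>w. w_solution x y1 y2 \<rho> w)
    \<and> (\<exists>!u. cubic_root x y1 y2 \<rho> u \<and> (\<forall>w. w_solution x y1 y2 \<rho> w \<longrightarrow> norm w = u))
    \<and> (\<forall>w. w_solution x y1 y2 \<rho> w \<longleftrightarrow>
          greatest_cubic_root x y1 y2 \<rho> (norm w)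
          \<and> (2 * (norm w)\<^sup>2 - 1 + 2 * y1 / \<rho>) *\<^sub>R w = x - y2 /\<^sub>R \<rho>)
    \<and> (x - y2 /\<^sub>R \<rho> \<noteq> 0 \<or> y1 / \<rho> > 1 / 2 \<longrightarrow>
          (\<exists>!w. w_solution x y1 y2 \<rho> w)
          \<and> (\<forall>w. w_solution x y1 y2 \<rho> w \<longleftrightarrow>
                greatest_cubic_root x y1 y2 \<rho> (norm w)
                \<and> 2 * (norm w)\<^sup>2 - 1 + 2 * y1 / \<rho> \<noteq> 0
                \<and> w = (x - y2 /\<^sub>R \<rho>) /\<^sub>R (2 * (norm w)\<^sup>2 - 1 + 2 * y1 / \<rho>)))"
proof -
  obtain w0 where w0: "greatest_cubic_root x y1 y2 \<rho> (norm w0)"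
    "(2 * (norm w0)\<^sup>2 - 1 + 2 * y1 / \<rho>) *\<^sub>R w0 = x - y2 /\<^sub>R \<rho>"
    by (rule stationary_point_exists)
  note sol = stationary_point_solution[OF w0]
  have ex1_root: "\<exists>!u. cubic_root x y1 y2 \<rho> u \<and> (\<forall>w. w_solution x y1 y2 \<rho> w \<longrightarrow> norm w = u)"
  proof (rule ex1I)
    show "cubic_root x y1 y2 \<rho> (norm w0) \<and> (\<forall>w. w_solution x y1 y2 \<rho> w \<longrightarrow> norm w = norm w0)"
      using w0(1) solution_compare(1)[OF w0] unfolding greatest_cubic_root_def by blast
  next
    fix u assume "cubic_root x y1 y2 \<rho> u \<and> (\<forall>w. w_solution x y1 y2 \<rho> w \<longrightarrow> norm w = u)"
    then show "u = norm w0" using sol by blast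
  qed
  have nondegenerate: "(\<exists>!w. w_solution x y1 y2 \<rho> w)
      \<and> (\<forall>w. w_solution x y1 y2 \<rho> w \<longleftrightarrow>
            greatest_cubic_root x y1 y2 \<rho> (norm w)
            \<and> 2 * (norm w)\<^sup>2 - 1 + 2 * y1 / \<rho> \<noteq> 0
            \<and> w = (x - y2 /\<^sub>R \<rho>) /\<^sub>R (2 * (norm w)\<^sup>2 - 1 + 2 * y1 / \<rho>))"
    if nondeg: "x - y2 /\<^sub>R \<rho> \<noteq> 0 \<or> y1 / \<rho> > 1 / 2"
  proof (intro conjI allI)
    show "\<exists>!w. w_solution x y1 y2 \<rho> w"
    proof (rule ex1I, rule sol)
      fix v assume "w_solution x y1 y2 \<rho> v"
      then show "v = w0"
        using solution_compare(2)[OF w0] solution_slope_nonzero[OF sol nondeg] by blast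
    qed
  next
    fix w :: "real ^ 'm"
    define s where "s = 2 * (norm w)\<^sup>2 - 1 + 2 * y1 / \<rho>"
    \<comment> \<open>Division by \<open>0\<close> yields \<open>0\<close>, so product and quotient
      form can differ when \<open>s = 0\<close>. Nonvanishing is a conjunct on the quotient side and
      follows from \<open>solution_slope_nonzero\<close> on the other.\<close>
    have "s *\<^sub>R w = z \<longleftrightarrow> w = z /\<^sub>R s" if "s \<noteq> 0" for z
      using divideR_right[OF that] by blast
    moreover have "w_solution x y1 y2 \<rho> w \<Longrightarrow> s \<noteq> 0"
      unfolding s_def using nondeg by (rule solution_slope_nonzero[rotated])
    ultimately show "w_solution x y1 y2 \<rho> w \<longleftrightarrow>
        greatest_cubic_root x y1 y2 \<rho> (norm w)
        \<and> 2 * (norm w)\<^sup>2 - 1 + 2 * y1 / \<rho> \<noteq> 0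
        \<and> w = (x - y2 /\<^sub>R \<rho>) /\<^sub>R (2 * (norm w)\<^sup>2 - 1 + 2 * y1 / \<rho>)"
      unfolding w_solution_iff s_def[symmetric] by blast
  qed
  show ?thesis
    by (intro conjI[OF exI[of _ w0]] conjI[OF ex1_root] conjI[OF allI] impI
        sol w_solution_iff nondegenerate)
qed

end
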